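(* Let $n$ and $k$ be positive integers with $n\geq 2$ and $n\geq k$. Then $r_2(n,k)=R_2(n+1,k)$; that is, the 2-color Rado number of the equation $x_1+x_2+\cdots+x_n=y_1+y_2+\cdots+y_k$ equals the 2-color Rado number of the equation $x_1+x_2+\cdots+x_n=ky$.
   Context: For a positive integer $r$ write $[r]=\{1,\ldots,r\}$. The 2-color Rado number of an equation is the smallest positive integer $r$ such that for every coloring of the elements of $[r]$ with two colors there exists a solution of the equation using elements of $[r]$ that are all colored the same (a monochromatic solution). The values of distinct variables in a solution are not required to be distinct. (By a theorem of Rado, this number exists for every equation $a_1x_1+\cdots+a_nx_n=b_1y_1+\cdots+b_ky_k$ with all $a_i,b_j$ positive integers, $n,k\geq 1$ and $n+k\geq 3$.) Notation: $R_2(m,a)$ denotes the 2-color Rado number of $x_1+x_2+\cdots+x_{m-1}=ax_m$, and $r_2(n,k)$ denotes the 2-color Rado number of $x_1+x_2+\cdots+x_n=y_1+y_2+\cdots+y_k$. *)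

theory Defs
  imports Main
begin

(* The equation  a 1 * x 1 + ... + a n * x n = b 1 * y 1 + ... + b k * y k,
   to be solved in {1..r} within a single colour class of c.
   Values of x outside {1..n} and of y outside {1..k} are irrelevant, as are
   the colours of numbers outside {1..r}. *)
definition mono_solution ::
    "nat \<Rightarrow> (nat \<Rightarrow> nat) \<Rightarrow> nat \<Rightarrow> (nat \<Rightarrow> nat) \<Rightarrow> nat \<Rightarrow> (nat \<Rightarrow> bool)
       \<Rightarrow> (nat \<Rightarrow> nat) \<Rightarrow> (nat \<Rightarrow> nat) \<Rightarrow> bool" where
  "mono_solution n a k b r c x y \<longleftrightarrow>
     (\<forall>i\<in>{1..n}. x i \<in> {1..r}) \<and>
     (\<forall>j\<in>{1..k}. y j \<in> {1..r}) \<and>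
     (\<Sum>i=1..n. a i * x i) = (\<Sum>j=1..k. b j * y j) \<and>
     (\<exists>d. (\<forall>i\<in>{1..n}. c (x i) = d) \<and> (\<forall>j\<in>{1..k}. c (y j) = d))"

(* By Rado's theorem, the minimum exists whenever n, k >= 1, n + k >= 3 and all
   coefficients are positive; outside that range the value may be unspecified. *)
definition rado_number2 ::
    "nat \<Rightarrow> (nat \<Rightarrow> nat) \<Rightarrow> nat \<Rightarrow> (nat \<Rightarrow> nat) \<Rightarrow> nat" where
  "rado_number2 n a k b =
     (LEAST r. 0 < r \<and> (\<forall>c. \<exists>x y. mono_solution n a k b r c x y))"

definition R2 :: "nat \<Rightarrow> nat \<Rightarrow> nat" where
  "R2 m a = rado_number2 (m - 1) (\<lambda>_. 1) 1 (\<lambda>_. a)"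

definition r2 :: "nat \<Rightarrow> nat \<Rightarrow> nat" where
  "r2 n k = rado_number2 n (\<lambda>_. 1) k (\<lambda>_. 1)"

end

theory Submission
  imports Defs
begin

text \<open>
  Write (M) for the equation \<open>x\<^sub>1 + \<dots> + x\<^sub>n = y\<^sub>1 + \<dots> + y\<^sub>k\<close> and (S) for
  \<open>x\<^sub>1 + \<dots> + x\<^sub>n = k y\<close>. Both Rado numbers are least elements, so it suffices to show, for
  each \<open>r > 0\<close>, that every 2-colouring of \<open>[r]\<close> has a monochromatic solution of (M) if and only
  if every 2-colouring of \<open>[r]\<close> has one of (S). A solution of (S) is a solution of (M) with
  equal \<open>y\<^sub>j\<close>. The content is the converse: a colouring of \<open>[r]\<close> that avoids (S) must yield
  a colouring, possibly a different one, that avoids (M). For \<open>k = 1\<close> the equations coincide, and for \<open>n = k\<close> the number 1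
  alone solves (S).

  Let \<open>q = \<lceil>n/k\<rceil>\<close>. If \<open>k r < n q\<close>, then colouring \<open>[1, q - 1]\<close> and \<open>[q, r]\<close> differently
  avoids (M), because in either block the left-hand side exceeds the right-hand side
  (\<open>many_avoidable_blocks\<close>). So suppose \<open>k r \<ge> n q\<close>.

  If \<open>n > 2k\<close>, no colouring of \<open>[r]\<close> avoids (S) (\<open>no_cover_large\<close>). The engine is that an
  interval of values inside one class produces an interval of sums, so an interval of candidates
  \<open>y\<close> is forced into the other class, and this interval is long enough to solve (S) there.
  The colours of 1, 2, 3 decide how this starts: 1 and 2 agree (\<open>no_cover_one_two\<close>), 2 and 3 agree against 1 (\<open>no_cover_two_three\<close>), or
  1 and 3 agree against 2 (\<open>no_cover_one_three\<close>).

  If \<open>k < n \<le> 2k\<close>, a colouring that avoids (S) cannot reach the number 5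
  (\<open>small_forced\<close>). This leaves \<open>r = 3\<close> and \<open>r = 4\<close>, where (S) can be avoided only if
  \<open>n\<close> and \<open>k\<close> are incongruent modulo 2, respectively modulo 3, and for \<open>r = 4\<close> only if
  \<open>3k < 2n\<close> as well. These conditions in turn make the classes \<open>{1,3}, {2}\<close>, respectively
  \<open>{1,4}, {2,3}\<close>, free of solutions of (M), the first by congruence and the second by size
  (\<open>many_avoidable_small\<close>).
\<close>

section \<open>Iterated sumsets\<close>

primrec nfold :: "nat set \<Rightarrow> nat \<Rightarrow> nat set" where
  "nfold S 0 = {0}"
| "nfold S (Suc m) = {a + s | a s. a \<in> S \<and> s \<in> nfold S m}"

text \<open>
  The recursive \<open>nfold\<close> replaces assignments \<open>x 1, \<dots>, x m\<close> by the sums they produce; this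
  lemma is the bridge to the functions that occur in \<open>mono_solution\<close>.
\<close>

lemma nfold_iff_fun:
  "s \<in> nfold S m \<longleftrightarrow> (\<exists>x. (\<forall>i\<in>{1..m}. x i \<in> S) \<and> (\<Sum>i=1..m. x i) = s)"
proof (induction m arbitrary: s)
  case (Suc m)
  show ?case
  proof
    assume "s \<in> nfold S (Suc m)"
    then obtain a s' where a: "a \<in> S" "s' \<in> nfold S m" "s = a + s'" by auto
    then obtain x where x: "\<forall>i\<in>{1..m}. x i \<in> S" "(\<Sum>i=1..m. x i) = s'"
      using Suc.IH by blast
    have "(\<Sum>i=1..m. (x(Suc m := a)) i) = (\<Sum>i=1..m. x i)"
      by (intro sum.cong) auto
    then have "(\<Sum>i=1..Suc m. (x(Suc m := a)) i) = s" using x a by simp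
    moreover have "\<forall>i\<in>{1..Suc m}. (x(Suc m := a)) i \<in> S" using x a by auto
    ultimately show "\<exists>x. (\<forall>i\<in>{1..Suc m}. x i \<in> S) \<and> (\<Sum>i=1..Suc m. x i) = s" by blast
  next
    assume "\<exists>x. (\<forall>i\<in>{1..Suc m}. x i \<in> S) \<and> (\<Sum>i=1..Suc m. x i) = s"
    then obtain x where x: "\<forall>i\<in>{1..Suc m}. x i \<in> S" "(\<Sum>i=1..Suc m. x i) = s" by blast
    then have "(\<Sum>i=1..m. x i) \<in> nfold S m" using Suc.IH by fastforce
    moreover have "s = x (Suc m) + (\<Sum>i=1..m. x i)" using x by simp
    moreover have "x (Suc m) \<in> S" using x by simp
    ultimately show "s \<in> nfold S (Suc m)" by auto
  qed
qed auto

lemma nfold_add: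
  "s \<in> nfold S m \<Longrightarrow> s' \<in> nfold S m' \<Longrightarrow> s + s' \<in> nfold S (m + m')"
proof (induction m arbitrary: s)
  case (Suc m)
  then obtain a s0 where a: "a \<in> S" "s0 \<in> nfold S m" "s = a + s0" by auto
  have "s0 + s' \<in> nfold S (m + m')" using Suc a by blast
  then show ?case using a by (auto simp: add.assoc)
qed simp

lemma nfold_const: "a \<in> S \<Longrightarrow> m * a \<in> nfold S m"
  by (induction m) auto

lemma nfold_interval:
  assumes "{a..b} \<subseteq> S" "a \<le> b" "m * a \<le> s" "s \<le> m * b"
  shows "s \<in> nfold S m"
  using assms(3,4)
proof (induction m arbitrary: s)
  case (Suc m)
  \<comment> \<open>The greedy choice: the largest value that leaves at least \<open>a\<close> for each other summand.\<close>
  define v where "v = min b (s - m * a)"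
  have v: "a \<le> v" "v \<le> b" "v \<le> s" using Suc.prems assms(2) by (auto simp: v_def)
  have "m * a \<le> m * b" using assms(2) by simp
  then have "m * a \<le> s - v" "s - v \<le> m * b" using Suc.prems
    by (auto simp: v_def min_def split: if_splits)
  then have "s - v \<in> nfold S m" by (rule Suc.IH)
  moreover have "v \<in> S" using v assms(1) by auto
  moreover have "s = v + (s - v)" using v(3) by simp
  ultimately show ?case unfolding nfold.simps by blast
qed simp

lemma nfold_two:
  assumes "a \<in> S" "b \<in> S" "j \<le> m" "s = (m - j) * a + j * b"
  shows "s \<in> nfold S m"
  using nfold_add[OF nfold_const[OF assms(1), of "m - j"] nfold_const[OF assms(2), of j]] assms
  by simp

text \<open>
  The main tool for exhibiting solutions: one small value takes the bulk of the positions, and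
  \<open>j\<close> positions ranging over an interval absorb the difference to the target.
\<close>

lemma nfold_const_interval:
  assumes "a \<in> S" "{u..v} \<subseteq> S" "u \<le> v" "j \<le> m"
    "(m - j) * a + j * u \<le> s" "s \<le> (m - j) * a + j * v"
  shows "s \<in> nfold S m"
proof -
  have "s - (m - j) * a \<in> nfold S j"
    using assms by (intro nfold_interval[of u v]) auto
  then show ?thesis
    using nfold_add[OF nfold_const[OF assms(1), of "m - j"], of "s - (m - j) * a" j] assms by simp
qed

lemma nfold_bounds:
  assumes "\<forall>v\<in>S. a \<le> v \<and> v \<le> b" "s \<in> nfold S m"
  shows "m * a \<le> s \<and> s \<le> m * b"
  using assms(2)
proof (induction m arbitrary: s)
  case (Suc m)
  then obtain v s0 where "v \<in> S" "s0 \<in> nfold S m" "s = v + s0" by auto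
  then show ?case using Suc.IH[of s0] assms(1) by auto
qed simp

lemma nfold_mod:
  assumes "\<forall>v\<in>S. v mod g = (1::nat)" "s \<in> nfold S m"
  shows "s mod g = m mod g"
  using assms(2)
proof (induction m arbitrary: s)
  case (Suc m)
  then obtain v s0 where *: "v \<in> S" "s0 \<in> nfold S m" "s = v + s0" by auto
  then have "s mod g = (1 + m) mod g" using Suc.IH[of s0] assms(1)
    by (metis mod_add_cong mod_mod_trivial)
  then show ?case by simp
qed simp

section \<open>Colour classes\<close>

definition colour_class :: "nat \<Rightarrow> (nat \<Rightarrow> bool) \<Rightarrow> bool \<Rightarrow> nat set" where
  "colour_class r c d = {v \<in> {1..r}. c v = d}"

lemma mono_solution_many_iff:
  "(\<exists>x y. mono_solution n (\<lambda>_. 1) k (\<lambda>_. 1) r c x y) \<longleftrightarrow>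
     (\<exists>d. nfold (colour_class r c d) n \<inter> nfold (colour_class r c d) k \<noteq> {})"
  (is "?L \<longleftrightarrow> ?R")
proof
  assume ?L
  then obtain x y d where "\<forall>i\<in>{1..n}. x i \<in> {1..r}" "\<forall>j\<in>{1..k}. y j \<in> {1..r}"
    "(\<Sum>i=1..n. x i) = (\<Sum>j=1..k. y j)"
    "\<forall>i\<in>{1..n}. c (x i) = d" "\<forall>j\<in>{1..k}. c (y j) = d"
    unfolding mono_solution_def mult_1 by (elim exE conjE) (rule that)
  then have "\<forall>i\<in>{1..n}. x i \<in> colour_class r c d"
    "\<forall>j\<in>{1..k}. y j \<in> colour_class r c d" "(\<Sum>i=1..n. x i) = (\<Sum>j=1..k. y j)"
    unfolding colour_class_def by blast+
  then have "(\<Sum>i=1..n. x i) \<in> nfold (colour_class r c d) n"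
    "(\<Sum>i=1..n. x i) \<in> nfold (colour_class r c d) k"
    unfolding nfold_iff_fun by auto
  then show ?R by blast
next
  assume ?R
  then obtain d x y where "\<forall>i\<in>{1..n}. x i \<in> colour_class r c d"
    "\<forall>j\<in>{1..k}. y j \<in> colour_class r c d" "(\<Sum>i=1..n. x i) = (\<Sum>j=1..k. y j)"
    by (auto simp: nfold_iff_fun set_eq_iff)
  then have "mono_solution n (\<lambda>_. 1) k (\<lambda>_. 1) r c x y"
    unfolding mono_solution_def colour_class_def by auto
  then show ?L by blast
qed

lemma mono_solution_one_iff:
  "(\<exists>x y. mono_solution n (\<lambda>_. 1) 1 (\<lambda>_. k) r c x y) \<longleftrightarrow>
     (\<exists>d. \<exists>y\<in>colour_class r c d. k * y \<in> nfold (colour_class r c d) n)"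
  (is "?L \<longleftrightarrow> ?R")
proof
  assume ?L
  then obtain x y where "mono_solution n (\<lambda>_. 1) 1 (\<lambda>_. k) r c x y" by blast
  then obtain d where "\<forall>i\<in>{1..n}. x i \<in> {1..r} \<and> c (x i) = d"
    "y 1 \<in> {1..r} \<and> c (y 1) = d" "(\<Sum>i=1..n. x i) = k * y 1"
    unfolding mono_solution_def by auto
  then have "\<forall>i\<in>{1..n}. x i \<in> colour_class r c d"
    "y 1 \<in> colour_class r c d" "(\<Sum>i=1..n. x i) = k * y 1"
    unfolding colour_class_def by blast+
  then show ?R unfolding nfold_iff_fun by blast
next
  assume ?R
  then obtain d x y where "\<forall>i\<in>{1..n}. x i \<in> colour_class r c d"
    "y \<in> colour_class r c d" "(\<Sum>i=1..n. x i) = k * y"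
    by (auto simp: nfold_iff_fun)
  then have "mono_solution n (\<lambda>_. 1) 1 (\<lambda>_. k) r c x (\<lambda>_. y)"
    unfolding mono_solution_def colour_class_def by auto
  then show ?L by blast
qed

text \<open>
  No solution of the equation with a single right-hand variable lies in the set. The arguments
  below cover \<open>{1..r}\<close> by two such sets instead of fixing a colouring, which makes the two
  colours interchangeable.
\<close>

definition solution_free :: "nat \<Rightarrow> nat \<Rightarrow> nat set \<Rightarrow> bool" where
  "solution_free n k S \<longleftrightarrow> (\<forall>y\<in>S. k * y \<notin> nfold S n)"

lemma solution_freeD: "solution_free n k S \<Longrightarrow> y \<in> S \<Longrightarrow> k * y \<in> nfold S n \<Longrightarrow> False"
  by (auto simp: solution_free_def)

lemma round_up:
  assumes "(k::nat) > 0"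
  obtains y where "T \<le> k * y" "k * y < T + k"
proof
  have *: "T + k - 1 = k * ((T + k - 1) div k) + (T + k - 1) mod k" by simp
  moreover have "(T + k - 1) mod k < k" using assms by simp
  ultimately show "T \<le> k * ((T + k - 1) div k)" "k * ((T + k - 1) div k) < T + k"
    using assms by linarith+
qed

lemma le_if_mult_less:
  fixes k y r :: nat
  assumes "k * y < k * r + k"
  shows "y \<le> r"
proof -
  have "k * y < k * Suc r" using assms by simp
  then show ?thesis using mult_less_cancel1[of k y "Suc r"] by simp
qed

lemma other_class: "{1..r} \<subseteq> A \<union> B \<Longrightarrow> 1 \<le> z \<Longrightarrow> z \<le> r \<Longrightarrow> z \<notin> A \<Longrightarrow> z \<in> B"
  by force

section \<open>Two-class covers when n > 2k\<close>

text \<open>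
  Let \<open>{1..p}\<close> be the longest initial segment inside \<open>A\<close>, and \<open>t = p + 1\<close>. The small values
  \<open>1, \<dots>, p\<close> fill every gap between multiples of a larger \<open>z \<in> A\<close>, so \<open>y = z\<close> would be
  solvable in \<open>A\<close>; hence all of \<open>[q, p (n - k + 1)]\<close> up to \<open>r\<close> lies in \<open>B\<close>. Since
  \<open>t, q, q + 1\<close> and one further element of this range are in \<open>B\<close>, they solve (S) there:
  \<open>n - k\<close> copies of \<open>t\<close> and \<open>k\<close> copies of \<open>q\<close> or \<open>q + 1\<close> can represent a block of
  \<open>k + 1\<close> consecutive sums, and so a multiple of \<open>k\<close>.
\<close>

lemma no_cover_one_two:
  fixes n k q r :: nat
  assumes free: "solution_free n k A" "solution_free n k B"
    and cover: "{1..r} \<subseteq> A \<union> B"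
    and k2: "k \<ge> 2" and nk: "n > 2 * k"
    and q: "n \<le> k * q" "k * q < n + k" and r: "n * q \<le> k * r"
    and A: "1 \<in> A" "2 \<in> A"
  shows False
proof -
  have q3: "q \<ge> 3"
  proof (rule ccontr)
    assume "\<not> q \<ge> 3"
    then have "k * q \<le> k * 2" by (intro mult_left_mono) auto
    then show False using q nk by linarith
  qed
  have "2 * k * q \<le> n * q" using nk by (intro mult_right_mono) auto
  then have "k * (2 * q) \<le> k * r" using r by (metis order_trans mult.assoc mult.commute)
  then have r2q: "2 * q \<le> r" using k2 by (metis mult_le_cancel1 not_numeral_le_zero gr0I)
  have qA: "q \<notin> A"
  proof
    assume "q \<in> A"
    moreover have "{1..2} \<subseteq> A" using A by (auto simp: numeral_2_eq_2 le_Suc_eq)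
    then have "k * q \<in> nfold A n" using q nk by (intro nfold_interval[of 1 2]) auto
    ultimately show False using solution_freeD[OF free(1)] by blast
  qed
  define t where "t = (LEAST t. t \<ge> 1 \<and> t \<notin> A)"
  have t: "t \<ge> 1" "t \<notin> A" "t \<le> q"
    using LeastI[of "\<lambda>t. t \<ge> 1 \<and> t \<notin> A" q] Least_le[of "\<lambda>t. t \<ge> 1 \<and> t \<notin> A" q] qA q3
    by (auto simp: t_def)
  have below: "v \<in> A" if "1 \<le> v" "v < t" for v
    using not_less_Least[of v "\<lambda>t. t \<ge> 1 \<and> t \<notin> A"] that by (auto simp: t_def)
  have t3: "t \<ge> 3"
  proof (rule ccontr)
    assume "\<not> t \<ge> 3"
    then have "t = 1 \<or> t = 2" using t(1) by linarith
    then show False using t(2) A by auto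
  qed
  define p where "p = t - 1"
  have p: "p \<ge> 2" "t = p + 1" "{1..p} \<subseteq> A" using t3 below by (auto simp: p_def)
  have in_B: "z \<in> B" if z: "q \<le> z" "z \<le> p * (n - k + 1)" "z \<le> r" for z
  proof (rule ccontr)
    assume "z \<notin> B"
    then have zA: "z \<in> A" using other_class[OF cover, of z] z q3 by auto
    \<comment> \<open>Use \<open>k - i\<close> copies of \<open>z\<close>, so that the other \<open>n - k + i\<close> variables must sum to
       \<open>i z\<close>; the least \<open>i\<close> for which their minimal sum is not too large works.\<close>
    define i where "i = (LEAST i. n - k \<le> i * (z - 1))"
    have "k * q \<le> k * z" using z by simp
    then have kz: "n - k \<le> k * (z - 1)"
      unfolding diff_mult_distrib2 using q by linarith
    have i: "n - k \<le> i * (z - 1)" "i \<le> k"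
      using LeastI[of "\<lambda>i. n - k \<le> i * (z - 1)", OF kz]
        Least_le[of "\<lambda>i. n - k \<le> i * (z - 1)", OF kz] by (auto simp: i_def)
    have i1: "i \<ge> 1" using i(1) nk by (cases i) auto
    have "\<not> n - k \<le> (i - 1) * (z - 1)"
      using not_less_Least[of "i - 1" "\<lambda>i. n - k \<le> i * (z - 1)"] i1 by (auto simp: i_def)
    then have pred: "(i - 1) * (z - 1) < n - k" by simp
    have iz: "i * z = i * (z - 1) + i" using z q3 by (cases z) auto
    have lo: "n - k + i \<le> i * z" using i iz by simp
    have hi: "i * z \<le> p * (n - k + i)"
    proof (cases "i = 1")
      case True then show ?thesis using z by simp
    next
      case False
      then have "i \<ge> 2" using i1 by simp
      then have "1 * (z - 1) \<le> (i - 1) * (z - 1)" by (intro mult_right_mono) auto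
      then have "z - 1 < n - k" using pred by linarith
      moreover have "i * (z - 1) = (i - 1) * (z - 1) + (z - 1)" using i1 by (cases i) auto
      ultimately have "i * (z - 1) \<le> (n - k) + (n - k)" using pred by linarith
      then have "i * z \<le> 2 * (n - k + i)" unfolding iz by simp
      also have "\<dots> \<le> p * (n - k + i)" using p by (intro mult_right_mono) auto
      finally show ?thesis .
    qed
    have "i * z \<in> nfold A (n - k + i)"
      using p lo hi by (intro nfold_interval[of 1 p]) (simp_all add: mult.commute)
    from nfold_add[OF nfold_const[OF zA, of "k - i"] this]
    have "k * z \<in> nfold A n"
      using i nk by (simp flip: add_mult_distrib)
    then show False using solution_freeD[OF free(1) zA] by blast
  qed
  define L where "L = p * (n - k + 1)"
  have L2: "2 * (n - k + 1) \<le> L" unfolding L_def using p by (intro mult_right_mono) auto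
  have "k * q = k * (q - 1) + k" using q3 by (cases q) auto
  moreover have "2 * (q - 1) \<le> k * (q - 1)" using k2 by (intro mult_right_mono) auto
  ultimately have "2 * (q - 1) < n" using q by linarith
  then have "2 * q < n + 2" by linarith
  moreover have "n + 3 \<le> L"
  proof -
    have "2 * (n - k) + 2 \<le> L" using L2 by simp
    moreover have "n = k + (n - k)" using nk by simp
    ultimately show ?thesis using nk by linarith
  qed
  ultimately have q1: "q + 1 \<le> L" by linarith
  have qB: "{q..q+1} \<subseteq> B"
  proof
    fix v assume "v \<in> {q..q+1}"
    then show "v \<in> B" using q1 r2q q3 by (intro in_B) (auto simp: L_def)
  qed
  have tB: "t \<in> B" using other_class[OF cover, of t] t r2q by simp
  obtain y where y: "t * (n - k) + k * q \<le> k * y" "k * y < t * (n - k) + k * q + k"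
    using round_up[of k] k2 by auto
  have "t * (n - k) + k * q \<le> q * (n - k) + k * q" using t by simp
  also have "\<dots> = n * q" using nk by (simp add: algebra_simps flip: add_mult_distrib2)
  finally have yr: "y \<le> r" using y r by (intro le_if_mult_less[of k]) linarith
  have "k * q \<le> k * y" using y by linarith
  then have yq: "q \<le> y" using k2 by simp
  have "t * (n - k) + k * q \<le> (p + 2) * (n - k) + 2 * k"
    using p q nk by (simp add: algebra_simps)
  also have "\<dots> \<le> (k * p) * (n - k) + k * p"
  proof (intro add_mono mult_right_mono)
    have "2 * p \<le> k * p" using k2 by simp
    then show "p + 2 \<le> k * p" using p by linarith
  qed (use p in auto)
  also have "\<dots> = k * L" by (simp add: L_def algebra_simps)
  finally have "y \<le> L" using y by (intro le_if_mult_less[of k]) linarith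
  then have yB: "y \<in> B" using in_B yq yr by (simp add: L_def)
  have "k * y \<in> nfold B n"
    using y tB qB nk by (intro nfold_const_interval[of t B q "q + 1" k]) (auto simp: algebra_simps)
  then show False using solution_freeD[OF free(2) yB] by blast
qed

text \<open>
  Sums over \<open>{2,3}\<close> force every \<open>y\<close> with \<open>2n \<le> k y \<le> 3n\<close> into \<open>A\<close>, and \<open>A\<close> also
  contains 1. To represent \<open>k y\<close> for such a \<open>y\<close>, some variables take values of the size
  of \<open>y\<close> and the others are small. The large values only cover the gaps between consecutive sums
  if their interval is long enough. If \<open>4 \<in> B\<close>, sums over \<open>{2,3,4}\<close> lengthen it; if
  \<open>4 \<in> A\<close>, replacing 1 by 4 gives steps of 3, and two large values close those. For \<open>k = 2\<close> and
  \<open>k = 3\<close> explicit solutions around \<open>n\<close> are available.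
\<close>

lemma no_cover_two_three:
  fixes n k r :: nat
  assumes free: "solution_free n k A" "solution_free n k B"
    and cover: "{1..r} \<subseteq> A \<union> B"
    and k2: "k \<ge> 2" and nk: "n > 2 * k" and r: "3 * n \<le> k * r"
    and one: "1 \<in> A" and "2 \<in> B" "3 \<in> B"
  shows False
proof -
  have le_r: "y \<le> r" if "k * y < 3 * n + k" for y
    using that r by (intro le_if_mult_less[of k]) linarith
  have in_A: "y \<in> A" if "2 * n \<le> k * y" "k * y \<le> 3 * n" for y
  proof (rule ccontr)
    assume "y \<notin> A"
    moreover have "y \<ge> 1" using that(1) nk by (cases y) auto
    ultimately have "y \<in> B" using other_class[OF cover] le_r[of y] that k2 by auto
    moreover have "{2..3} \<subseteq> B" using assms by (auto simp: eval_nat_numeral le_Suc_eq)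
    then have "k * y \<in> nfold B n" using that by (intro nfold_interval[of 2 3]) auto
    ultimately show False using solution_freeD[OF free(2)] by blast
  qed
  consider "k = 2" | "k = 3" | "k \<ge> 4" using k2 by linarith
  then show False
  proof cases
    case 1
    have "n \<in> A" "n + 1 \<in> A" using in_A 1 nk by auto
    then have "k * n \<in> nfold A n"
      using 1 nk one by (intro nfold_two[of 1 A "n + 1" 1]) auto
    then show False using solution_freeD[OF free(1)] \<open>n \<in> A\<close> by blast
  next
    case 2
    have A: "n \<in> A" "n - 1 \<in> A" using in_A 2 nk by auto
    have "{n - 1..n} \<subseteq> A"
    proof
      fix v assume "v \<in> {n - 1..n}"
      then have "v = n - 1 \<or> v = n" by auto
      then show "v \<in> A" using A by auto
    qed
    then have "k * (n - 1) \<in> nfold A n"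
      using 2 nk one by (intro nfold_const_interval[of 1 A "n - 1" n 2]) auto
    then show False using solution_freeD[OF free(1)] A by blast
  next
    case 3
    obtain w where w: "2 * n \<le> k * w" "k * w < 2 * n + k" using round_up[of k] k2 by auto
    have w1: "w \<ge> 1" using w nk by (cases w) auto
    have r4: "4 \<le> r" using le_r[of 4] nk by simp
    show False
    proof (cases "4 \<in> A")
      case True
      have wA: "w \<in> A" "w + 1 \<in> A" using w nk by (auto intro!: in_A)
      then have W: "{w..w+1} \<subseteq> A" by (auto simp: le_Suc_eq)
      \<comment> \<open>Solve for \<open>y = w\<close> with two large values: \<open>d\<close> is what remains after
         \<open>n - 2\<close> ones and \<open>2 w\<close>. Multiples of 3 in \<open>d\<close> come from fours, the remainder from
         replacing \<open>w\<close> by \<open>w + 1\<close>.\<close>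
      define d where "d = (k - 2) * w - (n - 2)"
      have "k * w \<le> (2 * (k - 2)) * w" using 3 by (intro mult_right_mono) auto
      also have "\<dots> = 2 * ((k - 2) * w)" by simp
      finally have "n \<le> (k - 2) * w" using w by linarith
      moreover have kw: "k * w = (k - 2) * w + 2 * w"
        using 3 le_add_diff_inverse2[of 2 k] by (metis add_mult_distrib k2)
      ultimately have d: "k * w = (n - 2) + d + 2 * w" "d \<le> 2 * n + 2"
        using w nk by (auto simp: d_def)
      define i f where "i = d div 3" and "f = d mod 3"
      have i: "d = 3 * i + f" "f \<le> 2" "i \<le> n - 2"
        using d nk 3 by (auto simp: i_def f_def)
      have "(n - 2) + 3 * i \<in> nfold A (n - 2)"
        using i True one by (intro nfold_two[of 1 A 4 i]) auto
      moreover have "2 * w + f \<in> nfold A 2"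
        using W i by (intro nfold_interval[of w "w + 1"]) auto
      ultimately have "(n - 2) + 3 * i + (2 * w + f) \<in> nfold A (n - 2 + 2)"
        by (rule nfold_add)
      moreover have "k * w = (n - 2) + 3 * i + (2 * w + f)" using d i by linarith
      moreover have "n - 2 + 2 = n" using nk k2 by linarith
      ultimately have "k * w \<in> nfold A n" by metis
      then show False using solution_freeD[OF free(1)] wA by blast
    next
      case False
      then have "4 \<in> B" using other_class[OF cover] r4 by auto
      then have B: "{2..4} \<subseteq> B" using assms by (auto simp: eval_nat_numeral le_Suc_eq)
      have in_A': "y \<in> A" if "2 * n \<le> k * y" "k * y < 3 * n + k" for y
      proof (rule ccontr)
        assume "y \<notin> A"
        moreover have "y \<ge> 1" using that(1) nk by (cases y) auto
        ultimately have "y \<in> B" using other_class[OF cover] le_r[of y] that k2 by auto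
        moreover have "k * y \<in> nfold B n"
          using that B nk by (intro nfold_interval[of 2 4]) auto
        ultimately show False using solution_freeD[OF free(2)] by blast
      qed
      obtain M where M: "3 * n \<le> k * M" "k * M < 3 * n + k" using round_up[of k] k2 by auto
      \<comment> \<open>Rounding up, to \<open>k M \<ge> 3n\<close>, is what guarantees \<open>M \<ge> w + 2\<close>.\<close>
      have WM: "{w..M} \<subseteq> A"
      proof
        fix v assume v: "v \<in> {w..M}"
        then have "k * w \<le> k * v" "k * v \<le> k * M" by auto
        then show "v \<in> A" using w M by (intro in_A') linarith+
      qed
      have "k * (w + 1) < k * M" using w M nk by simp
      then have "w + 1 < M" unfolding mult_less_cancel1 by blast
      then have wM: "w + 2 \<le> M" by simp
      \<comment> \<open>With \<open>j\<close> large values the sums cover an interval of length \<open>j (M - w) \<ge> k\<close>, which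
         contains a multiple of \<open>k\<close>; \<open>j\<close> near \<open>k/2\<close> keeps the quotient \<open>y\<close> in \<open>{w..M}\<close>.\<close>
      define j where "j = (k + 1) div 2"
      have j: "k \<le> 2 * j" "2 * j \<le> k + 1" "j \<le> n" using nk by (auto simp: j_def)
      have jw: "k * (w - 1) \<le> 2 * (j * (w - 1))" "2 * (j * (w - 1)) \<le> k * (w - 1) + (w - 1)"
        using mult_right_mono[OF j(1), of "w - 1"] mult_right_mono[OF j(2), of "w - 1"]
        by (simp_all only: add_mult_distrib mult.assoc mult_1)
      have kw: "k * w = k * (w - 1) + k" using w1 by (cases w) auto
      have w2n: "w - 1 \<le> k * (w - 1)" using k2 by simp
      obtain y where y: "n + j * (w - 1) \<le> k * y" "k * y < n + j * (w - 1) + k"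
        using round_up[of k] k2 by auto
      have "n + j * (w - 1) \<le> 3 * n" using jw kw w w2n by linarith
      then have yM: "y \<le> M" using y M by (intro le_if_mult_less[of k]) linarith
      have "k * (w - 1) < n + j * (w - 1)" using jw kw w by linarith
      then have "k * (w - 1) < k * y" using y by linarith
      then have "w - 1 < y" unfolding mult_less_cancel1 by blast
      then have yw: "w \<le> y" by linarith
      have "j * (w + 2) \<le> j * M" using wM by (rule mult_le_mono2)
      moreover have "j * w = j * (w - 1) + j" using w1 by (cases w) auto
      ultimately have "(n - j) * 1 + j * w \<le> k * y" "k * y \<le> (n - j) * 1 + j * M"
        using y j(1,3) unfolding add_mult_distrib2 by linarith+
      then have "k * y \<in> nfold A n"
        using j WM wM one by (intro nfold_const_interval[of 1 A w M j]) auto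
      moreover have "y \<in> A" using WM yM yw by auto
      ultimately show False using solution_freeD[OF free(1)] by blast
    qed
  qed
qed

text \<open>
  If \<open>4 \<in> B\<close>, then \<open>2, 4, 2q\<close> is a doubled copy of \<open>1, 2, q\<close> and forces \<open>2q\<close> into \<open>A\<close>.
  There \<open>k \<cdot> 2q\<close> is a sum of ones and threes when \<open>n\<close> is even; when \<open>n\<close> is odd, one summand
  equal to \<open>2q\<close> corrects the parity.

  If \<open>4 \<in> A\<close>, then \<open>1, 3, 4\<close> produce every sum from \<open>n + 2\<close> to \<open>4n\<close>, which forces
  \<open>[q + 1, \<lceil>3n/k\<rceil>]\<close> into \<open>B\<close>. Together with \<open>2 \<in> B\<close>, this interval solves (S) by the
  counting of \<open>no_cover_two_three\<close>, with 2 in the role of 1.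
\<close>

lemma no_cover_one_three:
  fixes n k q r :: nat
  assumes free: "solution_free n k A" "solution_free n k B"
    and cover: "{1..r} \<subseteq> A \<union> B"
    and k2: "k \<ge> 2" and nk: "n > 2 * k"
    and q: "n \<le> k * q" "k * q < n + k" and r: "3 * n \<le> k * r"
    and A: "1 \<in> A" "3 \<in> A" and B: "2 \<in> B"
  shows False
proof -
  have le_r: "y \<le> r" if "k * y < 3 * n + k" for y
    using that r by (intro le_if_mult_less[of k]) linarith
  have r4: "4 \<le> r" using le_r[of 4] nk by simp
  have q1: "q \<ge> 1" using q nk by (cases q) auto
  show False
  proof (cases "4 \<in> A")
    case False
    then have "4 \<in> B" using other_class[OF cover] r4 by auto
    have "2 * q \<in> A"
    proof (rule ccontr)
      assume "2 * q \<notin> A"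
      then have "2 * q \<in> B" using other_class[OF cover] le_r[of "2 * q"] q nk q1 by auto
      moreover have "k * (2 * q) \<in> nfold B n"
        using \<open>4 \<in> B\<close> B q nk
        by (intro nfold_two[of 2 B 4 "k * q - n"]) (auto simp: algebra_simps)
      ultimately show False using solution_freeD[OF free(2)] by blast
    qed
    moreover have "k * (2 * q) \<in> nfold A n"
    proof (cases "even n")
      case True
      then obtain h where "n = 2 * h" by blast
      then show ?thesis using A q nk
        by (intro nfold_two[of 1 A 3 "k * q - h"]) (auto simp: algebra_simps)
    next
      case False
      then obtain h where h: "n = 2 * h + 1" by (auto elim: oddE)
      have kq: "k * q = (k - 1) * q + q" using k2 by (cases k) auto
      have "1 * q \<le> (k - 1) * q" using k2 by (intro mult_right_mono) auto
      then have "h \<le> (k - 1) * q" using kq q h by linarith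
      moreover have "(k - 1) * q - h \<le> n - 1" using kq q h nk by linarith
      ultimately have "(k - 1) * (2 * q) \<in> nfold A (n - 1)" using A h
        by (intro nfold_two[of 1 A 3 "(k - 1) * q - h"]) (auto simp: algebra_simps)
      from nfold_add[OF this nfold_const[OF \<open>2 * q \<in> A\<close>, of 1]]
      have "(k - 1) * (2 * q) + 1 * (2 * q) \<in> nfold A (n - 1 + 1)" .
      moreover have "k * (2 * q) = (k - 1) * (2 * q) + 1 * (2 * q)" using k2 by (cases k) auto
      ultimately show ?thesis using nk by simp
    qed
    ultimately show False using solution_freeD[OF free(1)] by blast
  next
    case True
    then have A34: "{3..4} \<subseteq> A" using A by (auto simp: eval_nat_numeral le_Suc_eq)
    have in_B: "y \<in> B" if "n + 2 \<le> k * y" "k * y < 3 * n + k" for y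
    proof (rule ccontr)
      assume "y \<notin> B"
      moreover have "y \<ge> 1" using that(1) by (cases y) auto
      ultimately have "y \<in> A" using other_class[OF cover, of y] le_r[of y] that by blast
      moreover have "k * y \<in> nfold A n"
        using that A A34 nk
        by (intro nfold_const_interval[of 1 A 3 4 "(k * y - n + 2) div 3"]) auto
      ultimately show False using solution_freeD[OF free(1)] by blast
    qed
    obtain M where M: "3 * n \<le> k * M" "k * M < 3 * n + k" using round_up[of k] k2 by auto
    have QM: "{q + 1..M} \<subseteq> B"
    proof
      fix v assume v: "v \<in> {q + 1..M}"
      then have "k * (q + 1) \<le> k * v" "k * v \<le> k * M" by (auto simp del: mult_Suc_right)
      then have "k * q + k \<le> k * v" "k * v \<le> k * M" by auto
      then show "v \<in> B" using q M k2 by (intro in_B) linarith+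
    qed
    have "k * (q + 3) < k * M" using q M nk by (simp add: algebra_simps)
    then have "q + 3 < M" unfolding mult_less_cancel1 by blast
    then have qM: "q + 3 \<le> M" by simp
    \<comment> \<open>As \<open>j (M - (q + 1)) \<ge> k\<close>, the sums with \<open>j\<close> values from \<open>{q+1..M}\<close> and
       otherwise twos include a multiple of \<open>k\<close>.\<close>
    define j where "j = (k + 1) div 2"
    have j: "k \<le> 2 * j" "2 * j \<le> k + 1" "j \<le> n" using nk by (auto simp: j_def)
    have jq: "2 * (j * (q - 1)) \<le> k * (q - 1) + (q - 1)"
      using mult_right_mono[OF j(2), of "q - 1"] by (simp only: add_mult_distrib mult.assoc mult_1)
    have kq: "k * q = k * (q - 1) + k" using q1 by (cases q) auto
    have qn: "q - 1 \<le> k * (q - 1)" using k2 by simp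
    obtain y where y: "2 * n + j * (q - 1) \<le> k * y" "k * y < 2 * n + j * (q - 1) + k"
      using round_up[of k] k2 by auto
    have "2 * n + j * (q - 1) \<le> 3 * n" using jq kq q qn by linarith
    then have yM: "y \<le> M" using y M by (intro le_if_mult_less[of k]) linarith
    have "k * q < k * y" using y q nk by linarith
    then have yq: "q + 1 \<le> y" by simp
    have "j * (q + 3) \<le> j * M" using qM by (rule mult_le_mono2)
    moreover have "j * q = j * (q - 1) + j" using q1 by (cases q) auto
    ultimately have "(n - j) * 2 + j * (q + 1) \<le> k * y" "k * y \<le> (n - j) * 2 + j * M"
      using y j(1,3) unfolding add_mult_distrib2 diff_mult_distrib by linarith+
    then have "k * y \<in> nfold B n"
      using j QM qM B by (intro nfold_const_interval[of 2 B "q + 1" M j]) auto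
    moreover have "y \<in> B" using QM yM yq by auto
    ultimately show False using solution_freeD[OF free(2)] by blast
  qed
qed

lemma no_cover_large:
  fixes n k q r :: nat
  assumes free: "solution_free n k A" "solution_free n k B"
    and cover: "{1..r} \<subseteq> A \<union> B"
    and k2: "k \<ge> 2" and nk: "n > 2 * k"
    and q: "n \<le> k * q" "k * q < n + k" and r: "n * q \<le> k * r"
    and one: "1 \<in> A"
  shows False
proof -
  have "k * 2 < k * q" using q nk by linarith
  then have "3 \<le> q" by simp
  then have "n * 3 \<le> n * q" by simp
  then have r3: "3 * n \<le> k * r" using r by linarith
  then have "k * 3 < k * r" using nk by linarith
  then have "3 < r" by simp
  then have "2 \<in> A \<or> 2 \<in> B" "3 \<in> A \<or> 3 \<in> B"
    using other_class[OF cover, of 2] other_class[OF cover, of 3] by auto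
  then show False
    using no_cover_one_two[OF free cover k2 nk q r]
      no_cover_two_three[OF free cover k2 nk r3]
      no_cover_one_three[OF free cover k2 nk q r3] one by blast
qed

section \<open>Two-class covers when k < n \<le> 2k\<close>

text \<open>
  Each conclusion exhibits a solution of (S) within \<open>{1,2}\<close>, \<open>{2,3}\<close>, \<open>{2,4}\<close> or
  \<open>{1,3,4}\<close> with \<open>y\<close> the largest element. The number 5 fits into neither class, because
  \<open>{1,4,5}\<close> and \<open>{2,3,5}\<close> contain solutions with \<open>y = 5\<close>.
\<close>

lemma small_forced:
  fixes n k r :: nat
  assumes free: "solution_free n k A" "solution_free n k B"
    and cover: "{1..r} \<subseteq> A \<union> B"
    and nk: "k < n" "n \<le> 2 * k" and A: "1 \<in> A"
  shows "r \<ge> 2 \<Longrightarrow> 2 \<in> B"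
    and "r \<ge> 3 \<Longrightarrow> 2 * n \<le> 3 * k \<Longrightarrow> 3 \<in> A"
    and "r \<ge> 4 \<Longrightarrow> 4 \<in> A"
    and "r \<ge> 4 \<Longrightarrow> 3 \<in> B"
    and "r \<le> 4"
proof -
  show B2: "2 \<in> B" if "r \<ge> 2"
  proof (rule ccontr)
    assume "2 \<notin> B"
    then have "2 \<in> A" using other_class[OF cover, of 2] that by auto
    moreover from this have "k * 2 \<in> nfold A n"
      using A nk by (intro nfold_two[of 1 A 2 "2 * k - n"]) auto
    ultimately show False using solution_freeD[OF free(1)] by blast
  qed
  show "3 \<in> A" if "r \<ge> 3" "2 * n \<le> 3 * k"
  proof (rule ccontr)
    assume "3 \<notin> A"
    then have "3 \<in> B" using other_class[OF cover, of 3] that by auto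
    moreover from this have "k * 3 \<in> nfold B n"
      using B2 that nk by (intro nfold_two[of 2 B 3 "3 * k - 2 * n"]) auto
    ultimately show False using solution_freeD[OF free(2)] by blast
  qed
  show A4: "4 \<in> A" if "r \<ge> 4"
  proof (rule ccontr)
    assume "4 \<notin> A"
    then have "4 \<in> B" using other_class[OF cover, of 4] that by auto
    moreover from this have "k * 4 \<in> nfold B n"
      using B2 that nk by (intro nfold_two[of 2 B 4 "2 * k - n"]) auto
    ultimately show False using solution_freeD[OF free(2)] by blast
  qed
  show B3: "3 \<in> B" if "r \<ge> 4"
  proof (rule ccontr)
    assume "3 \<notin> B"
    then have "3 \<in> A" using other_class[OF cover, of 3] that by auto
    then have "{3..4} \<subseteq> A" using A4[OF that] by (auto simp: eval_nat_numeral le_Suc_eq)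
    then have "k * 4 \<in> nfold A n"
      using A nk by (intro nfold_const_interval[of 1 A 3 4 k]) auto
    then show False using solution_freeD[OF free(1)] A4[OF that] by blast
  qed
  show "r \<le> 4"
  proof (rule ccontr)
    assume r: "\<not> r \<le> 4"
    show False
    proof (cases "5 \<in> A")
      case True
      have "{4..5} \<subseteq> A" using A4 r True by (auto simp: eval_nat_numeral le_Suc_eq)
      then have "k * 5 \<in> nfold A n"
        using A nk by (intro nfold_const_interval[of 1 A 4 5 k]) auto
      then show False using solution_freeD[OF free(1) True] by blast
    next
      case False
      then have B5: "5 \<in> B" using other_class[OF cover, of 5] r by auto
      have "{2..3} \<subseteq> B" using B2 B3 r by (auto simp: eval_nat_numeral le_Suc_eq)
      then have "k * 5 \<in> nfold B n"
        using B5 nk by (intro nfold_const_interval[of 5 B 2 3 "2 * (n - k)"]) auto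
      then show False using solution_freeD[OF free(2) B5] by blast
    qed
  qed
qed

section \<open>Colourings without solutions and equality of the Rado numbers\<close>

text \<open>
  Some 2-colouring of \<open>{1..r}\<close> avoids (M): a monochromatic solution is a common value of \<open>n\<close>-fold
  and \<open>k\<close>-fold sums of one colour class.
\<close>

definition many_avoidable :: "nat \<Rightarrow> nat \<Rightarrow> nat \<Rightarrow> bool" where
  "many_avoidable n k r \<longleftrightarrow>
     (\<exists>c. \<forall>d. nfold (colour_class r c d) n \<inter> nfold (colour_class r c d) k = {})"

lemma disjoint_bounds:
  assumes "\<forall>v\<in>S. a \<le> v \<and> v \<le> b" "k * b < n * a"
  shows "nfold S n \<inter> nfold S k = {}"
proof (rule ccontr)
  assume "nfold S n \<inter> nfold S k \<noteq> {}"
  then obtain s where "s \<in> nfold S n" "s \<in> nfold S k" by blast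
  then have "n * a \<le> s" "s \<le> k * b" using nfold_bounds[OF assms(1)] by blast+
  then show False using assms(2) by linarith
qed

lemma disjoint_mod:
  assumes "\<forall>v\<in>S. v mod g = (1::nat)" "n mod g \<noteq> k mod g"
  shows "nfold S n \<inter> nfold S k = {}"
  using nfold_mod[OF assms(1)] assms(2) by (metis Int_iff equals0I)

lemma many_avoidableI:
  assumes "nfold {v\<in>{1..r}. P v} n \<inter> nfold {v\<in>{1..r}. P v} k = {}"
    "nfold {v\<in>{1..r}. \<not> P v} n \<inter> nfold {v\<in>{1..r}. \<not> P v} k = {}"
  shows "many_avoidable n k r"
  unfolding many_avoidable_def colour_class_def
proof (intro exI allI)
  fix d show "nfold {v\<in>{1..r}. P v = d} n \<inter> nfold {v\<in>{1..r}. P v = d} k = {}"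
    using assms by (cases d) auto
qed

text \<open>
  The first assumption says \<open>q - 1 < n/k\<close>: in the block below \<open>q\<close>, \<open>k\<close> summands stay below
  \<open>n\<close>. The second does the same for the block from \<open>q\<close> to \<open>r\<close>.
\<close>

lemma many_avoidable_blocks:
  assumes "k * q < n + k" "k * r < n * q" "n > 0"
  shows "many_avoidable n k r"
proof (rule many_avoidableI[where P = "\<lambda>v. v < q"])
  have "q > 0" using assms(2) by (cases q) auto
  then show "nfold {v\<in>{1..r}. v < q} n \<inter> nfold {v\<in>{1..r}. v < q} k = {}"
    using assms(1) by (intro disjoint_bounds[of _ 1 "q - 1"]) (auto simp: diff_mult_distrib2 less_diff_conv2)
  show "nfold {v\<in>{1..r}. \<not> v < q} n \<inter> nfold {v\<in>{1..r}. \<not> v < q} k = {}"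
    using assms(2) by (intro disjoint_bounds[of _ q r]) auto
qed

text \<open>
  The colouring that avoids (M) is an explicit one. The sets \<open>A\<close> and \<open>B\<close> enter only to derive
  the conditions under which it works: \<open>n\<close> and \<open>k\<close> are incongruent modulo 2 or 3, since otherwise
  \<open>{1,3}\<close> or \<open>{1,4}\<close> would contain a solution of (S), and for \<open>r = 4\<close> also \<open>3k < 2n\<close>, since
  otherwise 3 would be excluded from both classes.
\<close>

lemma many_avoidable_small:
  assumes free: "solution_free n k A" "solution_free n k B"
    and cover: "{1..r} \<subseteq> A \<union> B"
    and nk: "k < n" "n \<le> 2 * k" and A: "1 \<in> A" and r: "2 * n \<le> k * r"
  shows "many_avoidable n k r"
proof -
  note forced = small_forced[OF free cover nk A]
  have "k * 2 < k * r" using r nk by linarith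
  then have "r \<ge> 3" by simp
  then consider "r = 3" | "r = 4" using forced(5) by linarith
  then show ?thesis
  proof cases
    case 1
    have "n mod 2 \<noteq> k mod 2"
    proof
      assume "n mod 2 = k mod 2"
      then have "2 dvd n - k" using nk mod_eq_dvd_iff_nat[of k n 2] by simp
      then obtain i where "n - k = 2 * i" by (rule dvdE)
      then have "k * 3 = (n - (k - i)) * 1 + (k - i) * 3" using nk by simp
      moreover have "3 \<in> A" using forced(2) 1 r by simp
      ultimately have "k * 3 \<in> nfold A n"
        using A nk by (intro nfold_two[of 1 A 3 "k - i"]) auto
      then show False using solution_freeD[OF free(1) \<open>3 \<in> A\<close>] by blast
    qed
    then have "nfold {v \<in> {1..r}. v = 1 \<or> v = 3} n \<inter> nfold {v \<in> {1..r}. v = 1 \<or> v = 3} k = {}"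
      by (intro disjoint_mod[of _ 2]) auto
    moreover have "nfold {v \<in> {1..r}. \<not> (v = 1 \<or> v = 3)} n \<inter>
        nfold {v \<in> {1..r}. \<not> (v = 1 \<or> v = 3)} k = {}"
      using 1 nk by (intro disjoint_bounds[of _ 2 2]) auto
    ultimately show ?thesis by (rule many_avoidableI)
  next
    case 2
    have n3: "3 * k < 2 * n"
    proof (rule ccontr)
      assume "\<not> 3 * k < 2 * n"
      then have "3 \<in> A" "3 \<in> B" "2 \<in> B" using forced 2 by auto
      then have "k * 3 \<in> nfold B n" using \<open>\<not> 3 * k < 2 * n\<close> nk
        by (intro nfold_two[of 2 B 3 "3 * k - 2 * n"]) auto
      then show False using solution_freeD[OF free(2) \<open>3 \<in> B\<close>] by blast
    qed
    have "n mod 3 \<noteq> k mod 3"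
    proof
      assume "n mod 3 = k mod 3"
      then have "3 dvd n - k" using nk mod_eq_dvd_iff_nat[of k n 3] by simp
      then obtain i where "n - k = 3 * i" by (rule dvdE)
      then have "k * 4 = (n - (k - i)) * 1 + (k - i) * 4" using nk by simp
      moreover have "4 \<in> A" using forced(3) 2 by simp
      ultimately have "k * 4 \<in> nfold A n"
        using A nk by (intro nfold_two[of 1 A 4 "k - i"]) auto
      then show False using solution_freeD[OF free(1) \<open>4 \<in> A\<close>] by blast
    qed
    then have "nfold {v \<in> {1..r}. v = 1 \<or> v = 4} n \<inter> nfold {v \<in> {1..r}. v = 1 \<or> v = 4} k = {}"
      by (intro disjoint_mod[of _ 3]) auto
    moreover have "nfold {v \<in> {1..r}. \<not> (v = 1 \<or> v = 4)} n \<inter>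
        nfold {v \<in> {1..r}. \<not> (v = 1 \<or> v = 4)} k = {}"
      using 2 n3 by (intro disjoint_bounds[of _ 2 3]) auto
    ultimately show ?thesis by (rule many_avoidableI)
  qed
qed

lemma many_avoidable_if_cover:
  assumes free: "solution_free n k A" "solution_free n k B"
    and cover: "{1..r} \<subseteq> A \<union> B" and A: "1 \<in> A"
    and nk: "2 \<le> k" "k \<le> n"
  shows "many_avoidable n k r"
proof -
  obtain q where q: "n \<le> k * q" "k * q < n + k" using round_up[of k] nk by auto
  show ?thesis
  proof (cases "k * r < n * q")
    case True
    then show ?thesis using many_avoidable_blocks[OF q(2)] nk by simp
  next
    case False
    then have r: "n * q \<le> k * r" by simp
    consider "n = k" | "k < n" "n \<le> 2 * k" | "n > 2 * k" using nk by linarith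
    then show ?thesis
    proof cases
      case 1
      then show ?thesis using solution_freeD[OF free(1) A] nfold_const[OF A, of n] by auto
    next
      case 2
      have "k * 1 < k * q" using q 2 by linarith
      then have "2 \<le> q" by simp
      then have "n * 2 \<le> n * q" by simp
      then show ?thesis using many_avoidable_small[OF free cover 2 A] r by linarith
    next
      case 3
      then show ?thesis using no_cover_large[OF free cover nk(1) _ q r A] by blast
    qed
  qed
qed

lemma many_iff_one:
  assumes "1 \<le> k" "k \<le> n" "0 < r"
  shows "(\<forall>c. \<exists>x y. mono_solution n (\<lambda>_. 1) k (\<lambda>_. 1) r c x y) \<longleftrightarrow>
    (\<forall>c. \<exists>x y. mono_solution n (\<lambda>_. 1) 1 (\<lambda>_. k) r c x y)"
proof (cases "k = 1")
  case True
  then show ?thesis by simp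
next
  case False
  then have k2: "2 \<le> k" using assms by simp
  show ?thesis
  proof
    assume L: "\<forall>c. \<exists>x y. mono_solution n (\<lambda>_. 1) k (\<lambda>_. 1) r c x y"
    then have not_avoidable: "\<not> many_avoidable n k r"
      unfolding many_avoidable_def mono_solution_many_iff by blast
    show "\<forall>c. \<exists>x y. mono_solution n (\<lambda>_. 1) 1 (\<lambda>_. k) r c x y"
    proof (rule allI, rule ccontr)
      fix c assume "\<not> (\<exists>x y. mono_solution n (\<lambda>_. 1) 1 (\<lambda>_. k) r c x y)"
      then have "solution_free n k (colour_class r c d)" for d
        unfolding mono_solution_one_iff solution_free_def by blast
      moreover have "{1..r} \<subseteq> colour_class r c (c 1) \<union> colour_class r c (\<not> c 1)"
        "1 \<in> colour_class r c (c 1)"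
        using assms by (auto simp: colour_class_def)
      ultimately show False
        using many_avoidable_if_cover k2 assms(2) not_avoidable by blast
    qed
  next
    assume "\<forall>c. \<exists>x y. mono_solution n (\<lambda>_. 1) 1 (\<lambda>_. k) r c x y"
    then show "\<forall>c. \<exists>x y. mono_solution n (\<lambda>_. 1) k (\<lambda>_. 1) r c x y"
      unfolding mono_solution_one_iff mono_solution_many_iff
      using nfold_const by blast
  qed
qed

theorem theorem1:
  fixes n k :: nat
  assumes "n \<ge> 2" and "k \<ge> 1" and "n \<ge> k"
  shows "r2 n k = R2 (n + 1) k"
  unfolding r2_def R2_def rado_number2_def
  using many_iff_one[OF assms(2,3)] by (metis (no_types, lifting) add_diff_cancel_right')

end
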